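(* Let $\Gamma$ be a finite simple graph whose edges are each colored with exactly one of the colors red, green, blue, with $R$ red edges, $G$ green edges and $B$ blue edges, and let $K$ be the number of properly $3$-edge-colored copies of $K_4$ in $\Gamma$. Then $K \le \frac14 (RGB)^{2/3}$. Furthermore, if $K = \frac14 (RGB)^{2/3} > 0$, then $\Gamma$ is obtained from a balanced blowup of a properly colored $K_4$ by possibly adding a set of isolated vertices.
   Context: A properly $3$-edge-colored $K_4$ in $\Gamma$ is a set of four vertices of $\Gamma$ that are pairwise adjacent and such that each of the three color classes among the six edges is a perfect matching on these four vertices (opposite edges have the same color). A properly colored $K_4$ is the complete graph on four vertices colored in this way. A balanced blowup of it is obtained by replacing each vertex by an independent set of vertices, all four sets having the same (positive) size, and each edge of color $c$ by a complete bipartite graph between the corresponding two sets, all of whose edges have color $c$. *)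

theory Defs
  imports Complex_Main "HOL-Library.Disjoint_Sets"
begin

datatype color = Red | Green | Blue

text \<open>An edge is its two-element set of endpoints. Only the values of \<open>color_of\<close> on
  \<open>edges\<close> carry meaning; its values on other sets are never used.\<close>

record 'a colored_graph =
  verts :: "'a set"
  edges :: "'a set set"
  color_of :: "'a set \<Rightarrow> color"

definition finite_simple_graph :: "'a colored_graph \<Rightarrow> bool" where
  "finite_simple_graph \<Gamma> \<longleftrightarrow>
     finite (verts \<Gamma>) \<and> (\<forall>e\<in>edges \<Gamma>. e \<subseteq> verts \<Gamma> \<and> card e = 2)"

definition color_class :: "'a colored_graph \<Rightarrow> color \<Rightarrow> 'a set set" where
  "color_class \<Gamma> k = {e \<in> edges \<Gamma>. color_of \<Gamma> e = k}"

definition perfect_matching_on :: "'a set \<Rightarrow> 'a set set \<Rightarrow> bool" where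
  "perfect_matching_on S M \<longleftrightarrow>
     (\<forall>e\<in>M. e \<subseteq> S \<and> card e = 2) \<and> (\<forall>v\<in>S. \<exists>!e. e \<in> M \<and> v \<in> e)"

definition proper_K4_in :: "'a colored_graph \<Rightarrow> 'a set \<Rightarrow> bool" where
  "proper_K4_in \<Gamma> S \<longleftrightarrow>
     S \<subseteq> verts \<Gamma> \<and> card S = 4 \<and>
     (\<forall>u\<in>S. \<forall>v\<in>S. u \<noteq> v \<longrightarrow> {u, v} \<in> edges \<Gamma>) \<and>
     (\<forall>k. perfect_matching_on S {e \<in> color_class \<Gamma> k. e \<subseteq> S})"

definition num_proper_K4 :: "'a colored_graph \<Rightarrow> nat" where
  "num_proper_K4 \<Gamma> = card {S. proper_K4_in \<Gamma> S}"

definition properly_colored_K4 :: "'a colored_graph \<Rightarrow> bool" where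
  "properly_colored_K4 H \<longleftrightarrow> finite_simple_graph H \<and> proper_K4_in H (verts H)"

text \<open>\<open>P w\<close> is the independent set that replaces the vertex \<open>w\<close> of \<open>H\<close>, and \<open>n\<close> is the
  common size. A set of positive cardinality is finite.\<close>

definition balanced_blowup :: "'b colored_graph \<Rightarrow> 'a colored_graph \<Rightarrow> bool" where
  "balanced_blowup H \<Gamma> \<longleftrightarrow>
     (\<exists>P n. n > 0 \<and> (\<forall>w\<in>verts H. card (P w) = n) \<and>
        disjoint_family_on P (verts H) \<and>
        verts \<Gamma> = (\<Union>w\<in>verts H. P w) \<and>
        edges \<Gamma> = {{x, y} |x y u v. {u, v} \<in> edges H \<and> x \<in> P u \<and> y \<in> P v} \<and>
        (\<forall>u v x y. {u, v} \<in> edges H \<longrightarrow> x \<in> P u \<longrightarrow> y \<in> P v \<longrightarrow>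
           color_of \<Gamma> {x, y} = color_of H {u, v}))"

definition add_isolated_vertices :: "'a set \<Rightarrow> 'a colored_graph \<Rightarrow> 'a colored_graph" where
  "add_isolated_vertices I \<Gamma> = \<Gamma>\<lparr>verts := verts \<Gamma> \<union> I\<rparr>"

end

(*
Let Q be the set of labelled proper copies (x1, x2, x3, x4), so that |Q| = 4 K, with colours a on
12 and 34, b on 13 and 24, c on 14 and 23. It suffices that |Q| is at most the product of the
numbers of edges of any two colours: multiplying the three bounds gives the theorem.

With nA and nB the numbers of ordered edges of colours a and b, the bound says 4 |Q| <= nA nB.
For a copy q let t be the number of vertices that can replace x1, d the number of copies in which
a given vertex has a given label, and r, g the numbers of copies that contain the ordered
edges (x3, x4), (x4, x2) in these positions. The product of
  4 t d(x1) / |Q|,   r g / (t d(x4)),   |Q| / (nA r),   |Q| / (nB g)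
is 4 |Q| / (nA nB) times d(x1) / d(x4), and the last quotient has geometric mean 1 over Q. Each of
the four factors has arithmetic mean at most 1 over Q, for the first one because a vertex can
replace at most one of x1, ..., x4. Since ln y <= y - 1, the bound follows.

In the case of equality all factors are 1. Then every edge of colour a or b lies in a copy,
consecutive edges of colours a and b are completed to a triangle by one of colour c, every
non-isolated vertex can replace a vertex of a fixed copy, and the four sets of such replacements
have the same size: they are the parts of the blowup.
*)

theory Submission imports Defs begin

section \<open>Fibre sums and the logarithm inequality\<close>

text \<open>A fibre contributes its common value once, whatever its size. This enters the means of
  \<open>F2\<close>, \<open>F3\<close> and \<open>F4\<close>.\<close>

lemma sum_fibres:
  fixes f :: "'b \<Rightarrow> real"
  assumes "finite Q"
  shows "(\<Sum>q\<in>Q. f (\<pi> q) / real (card {q' \<in> Q. \<pi> q' = \<pi> q})) = sum f (\<pi> ` Q)"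
proof -
  have "(\<Sum>q | q \<in> Q \<and> \<pi> q = y. f (\<pi> q) / real (card {q' \<in> Q. \<pi> q' = \<pi> q})) = f y"
    if "y \<in> \<pi> ` Q" for y
  proof -
    have "card {q \<in> Q. \<pi> q = y} \<noteq> 0"
      using assms that by auto
    moreover have "(\<Sum>q | q \<in> Q \<and> \<pi> q = y. f (\<pi> q) / real (card {q' \<in> Q. \<pi> q' = \<pi> q}))
        = (\<Sum>q | q \<in> Q \<and> \<pi> q = y. f y / real (card {q' \<in> Q. \<pi> q' = y}))"
      by (rule sum.cong) auto
    ultimately show ?thesis by simp
  qed
  then show ?thesis
    by (subst sum.image_gen[OF assms, of _ \<pi>]) simp
qed

text \<open>Taking for \<open>P\<close> a condition on a second projection gives the marginal counts
  used in \<open>sum_F2\<close>.\<close>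

lemma sum_card_fibres:
  assumes "finite Q" "finite W" "\<pi> ` Q \<subseteq> W"
  shows "(\<Sum>a\<in>W. card {q \<in> Q. \<pi> q = a \<and> P q}) = card {q \<in> Q. P q}"
proof -
  have "card {q \<in> Q. P q} = card (\<Union>a\<in>W. {q \<in> Q. \<pi> q = a \<and> P q})"
    by (rule arg_cong[where f = card]) (use assms(3) in auto)
  also have "\<dots> = (\<Sum>a\<in>W. card {q \<in> Q. \<pi> q = a \<and> P q})"
    by (rule card_UN_disjoint) (use assms in auto)
  finally show ?thesis ..
qed

text \<open>Summing \<open>ln y \<le> y - 1\<close> gives the bound. In the case of equality the
  nonnegative gaps \<open>f q - 1 - ln (f q)\<close> sum to 0, so each of them is 0, which happens
  only at \<open>f q = 1\<close>.\<close>

lemma sum_ln_nonpos: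
  fixes f :: "'b \<Rightarrow> real"
  assumes fin: "finite Q" and pos: "\<And>q. q \<in> Q \<Longrightarrow> 0 < f q" and le: "sum f Q \<le> card Q"
  shows "(\<Sum>q\<in>Q. ln (f q)) \<le> 0"
    and "(\<Sum>q\<in>Q. ln (f q)) = 0 \<Longrightarrow> q \<in> Q \<Longrightarrow> f q = 1"
proof -
  have 1: "(\<Sum>q\<in>Q. f q - 1) \<le> 0"
    using le by (simp add: sum_subtractf)
  have 2: "ln (f q) \<le> f q - 1" if "q \<in> Q" for q
    using pos[OF that] by (rule ln_le_minus_one)
  have 3: "(\<Sum>q\<in>Q. ln (f q)) \<le> (\<Sum>q\<in>Q. f q - 1)"
    by (rule sum_mono) (rule 2)
  show "(\<Sum>q\<in>Q. ln (f q)) \<le> 0" using 1 3 by linarith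
  assume 0: "(\<Sum>q\<in>Q. ln (f q)) = 0" and q: "q \<in> Q"
  have "(\<Sum>q\<in>Q. f q - 1 - ln (f q)) = 0"
    using 0 1 3 by (simp add: sum_subtractf)
  then have "f q - 1 - ln (f q) = 0"
    using sum_nonneg_eq_0_iff[OF fin, of "\<lambda>q. f q - 1 - ln (f q)"] 2 q by auto
  then show "f q = 1" using ln_eq_minus_one pos[OF q] by simp
qed

section \<open>Labelled copies and their symmetries\<close>

declare split_paired_All [simp del] split_paired_Ex [simp del]

text \<open>Colours are relations on ordered pairs. \<open>A\<close> and \<open>B\<close> are the
  two colours whose edges are counted, \<open>C\<close> is the remaining one; the other pairs of
  colours are reached by instantiating the locale with the colours permuted.\<close>

locale edge_colors =
  fixes A B C :: "'a \<Rightarrow> 'a \<Rightarrow> bool"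
  assumes finite_A: "finite {(x, y). A x y}"
    and finite_B: "finite {(x, y). B x y}"
    and A_sym: "A x y \<Longrightarrow> A y x"
    and B_sym: "B x y \<Longrightarrow> B y x"
    and C_sym: "C x y \<Longrightarrow> C y x"
    and not_AB: "A x y \<Longrightarrow> \<not> B x y"
    and not_AC: "A x y \<Longrightarrow> \<not> C x y"
    and not_BC: "B x y \<Longrightarrow> \<not> C x y"
begin

definition K4 :: "'a \<times> 'a \<times> 'a \<times> 'a \<Rightarrow> bool" where
  "K4 = (\<lambda>(x, y, z, w). A x y \<and> A z w \<and> B x z \<and> B y w \<and> C x w \<and> C y z)"

abbreviation "Q \<equiv> Collect K4"

text \<open>The Klein four-group acting on the labels: each map swaps the ends of both edges of the
  named colour and so preserves all three colours. The maps bring vertex 2, 3 and 4, respectively,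
  into first position.\<close>

definition "\<sigma>A = (\<lambda>(x :: 'a, y :: 'a, z :: 'a, w :: 'a). (y, x, w, z))"
definition "\<sigma>B = (\<lambda>(x :: 'a, y :: 'a, z :: 'a, w :: 'a). (z, w, x, y))"
definition "\<sigma>C = (\<lambda>(x :: 'a, y :: 'a, z :: 'a, w :: 'a). (w, z, y, x))"

text \<open>For a copy these are the vertices that can stand in place of its first entry, that entry
  included; their number is t of the overview.\<close>

definition replacements :: "'a \<times> 'a \<times> 'a \<times> 'a \<Rightarrow> 'a set" where
  "replacements = (\<lambda>(x, y, z, w). {v. A v y \<and> B v z \<and> C v w})"

definition "p1 = (\<lambda>(x :: 'a, y :: 'a, z :: 'a, w :: 'a). x)"
definition "p4 = (\<lambda>(x :: 'a, y :: 'a, z :: 'a, w :: 'a). w)"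
definition "p2 = (\<lambda>(x :: 'a, y :: 'a, z :: 'a, w :: 'a). y)"
definition "p3 = (\<lambda>(x :: 'a, y :: 'a, z :: 'a, w :: 'a). z)"
text \<open>The edges 34 and 42 form a path with middle vertex 4. Both are oriented along it, and
  \<open>p234\<close> lists the middle vertex first.\<close>

definition "pA q = (p3 q, p4 q)"
definition "pB q = (p4 q, p2 q)"
definition "p234 q = (p4 q, p3 q, p2 q)"

text \<open>For \<open>p1\<close>, \<open>pA\<close> and \<open>pB\<close> these are the counts d, r
  and g of the overview; for \<open>p234\<close> it is t, by \<open>fibre_p234\<close>.\<close>

definition fibre :: "('a \<times> 'a \<times> 'a \<times> 'a \<Rightarrow> 'c) \<Rightarrow> 'c \<Rightarrow> nat" where
  "fibre \<pi> y = card {q \<in> Q. \<pi> q = y}"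

lemmas tuple_defs = K4_def \<sigma>A_def \<sigma>B_def \<sigma>C_def p1_def p2_def p3_def p4_def pA_def pB_def p234_def
  replacements_def

text \<open>A copy is determined by its two opposite edges of colour \<open>A\<close>.\<close>

lemma finite_Q: "finite Q"
proof (rule finite_subset)
  show "Q \<subseteq> (\<lambda>((x, y), (z, w)). (x, y, z, w)) ` ({(x, y). A x y} \<times> {(x, y). A x y})"
    by (force simp: K4_def image_iff)
  show "finite ((\<lambda>((x, y), (z, w)). (x, y, z, w)) ` ({(x, y). A x y} \<times> {(x, y). A x y}))"
    using finite_A by blast
qed

lemma fibre_pos:
  assumes "q \<in> Q"
  shows "fibre \<pi> (\<pi> q) > 0"
proof -
  have "q \<in> {q' \<in> Q. \<pi> q' = \<pi> q}" using assms by blast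
  moreover have "finite {q' \<in> Q. \<pi> q' = \<pi> q}" using finite_Q by (rule rev_finite_subset) blast
  ultimately show ?thesis unfolding fibre_def card_gt_0_iff by blast
qed

lemma \<sigma>_inv: "\<sigma>A (\<sigma>A q) = q" "\<sigma>B (\<sigma>B q) = q" "\<sigma>C (\<sigma>C q) = q"
  by (cases q; simp add: tuple_defs)+

lemma \<sigma>_in_Q: "q \<in> Q \<Longrightarrow> \<sigma>A q \<in> Q" "q \<in> Q \<Longrightarrow> \<sigma>B q \<in> Q" "q \<in> Q \<Longrightarrow> \<sigma>C q \<in> Q"
  using A_sym B_sym C_sym by (cases q; simp add: tuple_defs)+

lemma bij_\<sigma>: "bij_betw \<sigma>A Q Q" "bij_betw \<sigma>B Q Q" "bij_betw \<sigma>C Q Q"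
proof -
  show "bij_betw \<sigma>A Q Q"
    by (rule bij_betw_byWitness[where f' = \<sigma>A]) (use \<sigma>_inv(1) \<sigma>_in_Q(1) in blast)+
  show "bij_betw \<sigma>B Q Q"
    by (rule bij_betw_byWitness[where f' = \<sigma>B]) (use \<sigma>_inv(2) \<sigma>_in_Q(2) in blast)+
  show "bij_betw \<sigma>C Q Q"
    by (rule bij_betw_byWitness[where f' = \<sigma>C]) (use \<sigma>_inv(3) \<sigma>_in_Q(3) in blast)+
qed

lemma p1_\<sigma>C: "p1 (\<sigma>C q) = p4 q"
  by (cases q) (simp add: tuple_defs)

text \<open>The involution \<open>\<sigma>C\<close> exchanges the labels 1 and 4, so a vertex
  carries both labels equally often.\<close>

lemma fibre_p4: "fibre p4 v = fibre p1 v"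
proof -
  have p4: "p4 (\<sigma>C q) = p1 q" for q by (metis p1_\<sigma>C \<sigma>_inv(3))
  have "bij_betw \<sigma>C {q \<in> Q. p4 q = v} {q \<in> Q. p1 q = v}"
  proof (rule bij_betw_byWitness[where f' = \<sigma>C])
    show "\<sigma>C ` {q \<in> Q. p4 q = v} \<subseteq> {q \<in> Q. p1 q = v}"
      using \<sigma>_in_Q(3) p1_\<sigma>C by blast
    show "\<sigma>C ` {q \<in> Q. p1 q = v} \<subseteq> {q \<in> Q. p4 q = v}"
      using \<sigma>_in_Q(3) p4 by blast
  qed (simp_all only: \<sigma>_inv simp_thms ball_triv)
  then show ?thesis unfolding fibre_def by (rule bij_betw_same_card)
qed

text \<open>A copy with prescribed last three entries amounts to a choice of the first one, so t is
  itself a fibre size.\<close>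

lemma fibre_p234: 
  assumes "q \<in> Q"
  shows "fibre p234 (p234 q) = card (replacements q)"
proof -
  obtain x y z w where q: "q = (x, y, z, w)" by (cases q)
  have "{q' \<in> Q. p234 q' = p234 q} = (\<lambda>v. (v, y, z, w)) ` replacements q"
    using assms by (auto simp: tuple_defs q)
  moreover have "inj_on (\<lambda>v. (v, y, z, w)) (replacements q)" by (auto simp: inj_on_def)
  ultimately show ?thesis by (simp add: fibre_def card_image)
qed

lemma replacements_subset:
  assumes "q \<in> Q"
  shows "replacements q \<subseteq> p1 ` Q"
proof
  fix v assume v: "v \<in> replacements q"
  obtain x y z w where q: "q = (x, y, z, w)" by (cases q)
  have "(v, y, z, w) \<in> Q" using v assms by (auto simp: tuple_defs q)
  then show "v \<in> p1 ` Q" by (force simp: p1_def)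
qed

lemma finite_replacements: "q \<in> Q \<Longrightarrow> finite (replacements q)"
  by (rule finite_subset[OF replacements_subset finite_imageI[OF finite_Q]])

lemma sum_p1: "(\<Sum>v\<in>p1 ` Q. fibre p1 v) = card Q"
  using sum_card_fibres[OF finite_Q, of "p1 ` Q" p1 "\<lambda>_. True"] finite_Q
  by (simp add: fibre_def)

text \<open>Pairs of tuples that agree except in the first entry are counted from both sides.\<close>

lemma sum_replacements:
  fixes f :: "'a \<Rightarrow> real"
  shows "(\<Sum>q\<in>Q. \<Sum>v\<in>replacements q. f v) = (\<Sum>q\<in>Q. card (replacements q) * f (p1 q))"
proof -
  let ?S = "Sigma Q replacements"
  let ?\<tau> = "\<lambda>((x, y, z, w), v). ((v, y, z, w), x)"
  have "(\<Sum>q\<in>Q. \<Sum>v\<in>replacements q. f v) = (\<Sum>(q, v)\<in>?S. f v)"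
    by (rule sum.Sigma) (auto simp: finite_Q finite_replacements)
  also have "\<dots> = (\<Sum>(q, v)\<in>?S. f (p1 q))"
    by (rule sum.reindex_bij_witness[where i = ?\<tau> and j = ?\<tau>])
       (auto simp: tuple_defs)
  also have "\<dots> = (\<Sum>q\<in>Q. \<Sum>v\<in>replacements q. f (p1 q))"
    by (rule sum.Sigma[symmetric]) (auto simp: finite_Q finite_replacements)
  finally show ?thesis by simp
qed

definition all_replacements :: "'a \<times> 'a \<times> 'a \<times> 'a \<Rightarrow> 'a set" where
  "all_replacements q = replacements q \<union> replacements (\<sigma>A q) \<union> replacements (\<sigma>B q) \<union> replacements (\<sigma>C q)"

lemma all_replacements_subset: "q \<in> Q \<Longrightarrow> all_replacements q \<subseteq> p1 ` Q"
  unfolding all_replacements_def using replacements_subset \<sigma>_in_Q by blast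

text \<open>A vertex that replaces two vertices of a copy would be joined to each of the other two
  in two colours at once, so the four sets are disjoint. Each contributes the same total, because
  the symmetries permute \<open>Q\<close>.\<close>

lemma sum_all_replacements:
  fixes f :: "'a \<Rightarrow> real"
  shows "(\<Sum>q\<in>Q. 4 * card (replacements q) * f (p1 q)) = (\<Sum>q\<in>Q. \<Sum>v\<in>all_replacements q. f v)"
proof -
  let ?s = "\<lambda>q. \<Sum>v\<in>replacements q. f v"
  have disj: "replacements q \<inter> replacements (\<sigma>A q) = {}"
    "(replacements q \<union> replacements (\<sigma>A q)) \<inter> replacements (\<sigma>B q) = {}"
    "(replacements q \<union> replacements (\<sigma>A q) \<union> replacements (\<sigma>B q)) \<inter> replacements (\<sigma>C q) = {}" for q
    using not_AB not_AC not_BC by (cases q; force simp: tuple_defs)+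
  have "(\<Sum>v\<in>all_replacements q. f v) = ?s q + ?s (\<sigma>A q) + ?s (\<sigma>B q) + ?s (\<sigma>C q)" if "q \<in> Q" for q
    unfolding all_replacements_def
    using that by (simp add: sum.union_disjoint finite_replacements \<sigma>_in_Q[simplified] disj)
  then have "(\<Sum>q\<in>Q. \<Sum>v\<in>all_replacements q. f v)
      = sum ?s Q + (\<Sum>q\<in>Q. ?s (\<sigma>A q)) + (\<Sum>q\<in>Q. ?s (\<sigma>B q)) + (\<Sum>q\<in>Q. ?s (\<sigma>C q))"
    by (simp add: sum.distrib)
  also have "\<dots> = 4 * sum ?s Q"
    using sum.reindex_bij_betw[OF bij_\<sigma>(1), of ?s] sum.reindex_bij_betw[OF bij_\<sigma>(2), of ?s]
      sum.reindex_bij_betw[OF bij_\<sigma>(3), of ?s] by simp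
  finally show ?thesis by (simp add: sum_replacements sum_distrib_left mult.assoc)
qed

section \<open>The four factors, their means and the bound\<close>

abbreviation "T \<equiv> real (card Q)"
abbreviation "nA \<equiv> real (card {(x, y). A x y})"
abbreviation "nB \<equiv> real (card {(x, y). B x y})"

lemma pA_Q: "pA ` Q \<subseteq> {(x, y). A x y}" and pB_Q: "pB ` Q \<subseteq> {(x, y). B x y}"
  using B_sym by (auto simp: tuple_defs)

lemma T_pos: "q \<in> Q \<Longrightarrow> T > 0"
  using finite_Q card_gt_0_iff by fastforce

lemma nA_pos: "q \<in> Q \<Longrightarrow> nA > 0" and nB_pos: "q \<in> Q \<Longrightarrow> nB > 0"
  using finite_A finite_B pA_Q pB_Q card_gt_0_iff by fastforce+

definition "F1 q = 4 * real (card (replacements q)) * fibre p1 (p1 q) / T"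
text \<open>Here t is written as a fibre size of \<open>p234\<close>, so that
  \<open>sum_fibres\<close> turns the sum over copies into a sum over triples.\<close>

definition "F2 q = real (fibre pA (pA q)) * fibre pB (pB q) / fibre p4 (p4 q) / fibre p234 (p234 q)"
definition "F3 q = T / nA / fibre pA (pA q)"
definition "F4 q = T / nB / fibre pB (pB q)"

text \<open>By \<open>sum_all_replacements\<close>, each copy contributes the sum of d over a subset
  of the first entries, and d has total \<open>T\<close> over all first entries. Equality leaves no
  room for a missing vertex.\<close>

lemma sum_F1: "sum F1 Q \<le> T" (is ?le)
  and sum_F1_eq: "sum F1 Q = T \<Longrightarrow> q \<in> Q \<Longrightarrow> all_replacements q = p1 ` Q"
proof -
  let ?d = "\<lambda>v. real (fibre p1 v)"
  have eq: "sum F1 Q = (\<Sum>q\<in>Q. \<Sum>v\<in>all_replacements q. ?d v) / T"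
    unfolding F1_def sum_all_replacements[symmetric] sum_divide_distrib by simp
  have le: "(\<Sum>v\<in>all_replacements q. ?d v) \<le> T" if "q \<in> Q" for q
  proof -
    have "(\<Sum>v\<in>all_replacements q. ?d v) \<le> (\<Sum>v\<in>p1 ` Q. ?d v)"
      by (rule sum_mono2) (use finite_Q all_replacements_subset that in auto)
    then show ?thesis using sum_p1 by (metis of_nat_sum)
  qed
  have sle: "(\<Sum>q\<in>Q. \<Sum>v\<in>all_replacements q. ?d v) \<le> T * T"
    using sum_mono[of Q _ "\<lambda>_. T", OF le] by simp
  then show ?le unfolding eq by (simp add: divide_simps)
  assume T: "sum F1 Q = T" and q: "q \<in> Q"
  have "T > 0" using q by (rule T_pos)
  then have "(\<Sum>q\<in>Q. T - (\<Sum>v\<in>all_replacements q. ?d v)) = 0"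
    using T unfolding eq by (simp add: sum_subtractf field_simps)
  then have "(\<Sum>v\<in>all_replacements q. ?d v) = T"
    using sum_nonneg_eq_0_iff[OF finite_Q, of "\<lambda>q. T - (\<Sum>v\<in>all_replacements q. ?d v)"] le q by auto
  then have "(\<Sum>v\<in>all_replacements q. ?d v) = (\<Sum>v\<in>p1 ` Q. ?d v)"
    using sum_p1 by (metis of_nat_sum)
  \<comment> \<open>The missed vertices have total weight 0, while every first entry of a copy has
    positive weight.\<close>
  then have "(\<Sum>v\<in>p1 ` Q - all_replacements q. ?d v) = 0"
    using finite_Q all_replacements_subset[OF q] by (simp add: sum_diff)
  then have "\<forall>v\<in>p1 ` Q - all_replacements q. ?d v = 0"
    by (subst (asm) sum_nonneg_eq_0_iff) (use finite_Q in auto)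
  moreover have "?d v \<noteq> 0" if "v \<in> p1 ` Q" for v using that fibre_pos by (metis imageE less_irrefl of_nat_0_eq_iff)
  ultimately show "all_replacements q = p1 ` Q"
    using all_replacements_subset[OF q] by blast
qed

text \<open>The sum over the triples of copies is enlarged to a box of triples, where it can be
  computed exactly. Equality means that no triple of positive weight was added.\<close>

lemma sum_F2: "sum F2 Q \<le> T" (is ?le)
  and sum_F2_eq: "sum F2 Q = T \<Longrightarrow> (z, w) \<in> pA ` Q \<Longrightarrow> (w, y) \<in> pB ` Q \<Longrightarrow> (w, z, y) \<in> p234 ` Q"
proof -
  let ?f = "\<lambda>(w, z, y). real (fibre pA (z, w)) * fibre pB (w, y) / fibre p4 w"
  \<comment> \<open>A common finite range for the two outer vertices of the path.\<close>
  let ?W = "p2 ` Q \<union> p3 ` Q"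
  let ?P = "p4 ` Q \<times> ?W \<times> ?W"
  have finW: "finite ?W" using finite_Q by blast
  then have fin: "finite ?P" using finite_Q by blast
  have sub: "p234 ` Q \<subseteq> ?P" unfolding p234_def by blast
  have nn: "?f v \<ge> 0" for v by (cases v) simp
  have "F2 q = ?f (p234 q) / fibre p234 (p234 q)" for q
    by (simp add: F2_def pA_def pB_def p234_def)
  then have eq: "sum F2 Q = sum ?f (p234 ` Q)"
    using sum_fibres[OF finite_Q, of ?f p234] unfolding fibre_def[of p234] by simp
  have rA: "(\<Sum>z\<in>?W. fibre pA (z, w)) = fibre p4 w" for w
    using sum_card_fibres[OF finite_Q finW, of p3 "\<lambda>q. p4 q = w"]
    by (simp add: fibre_def pA_def)
  have rB: "(\<Sum>y\<in>?W. fibre pB (w, y)) = fibre p4 w" for w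
    using sum_card_fibres[OF finite_Q finW, of p2 "\<lambda>q. p4 q = w"]
    by (simp add: fibre_def pB_def conj_commute)
  have "sum ?f ?P = (\<Sum>w\<in>p4 ` Q. \<Sum>z\<in>?W. \<Sum>y\<in>?W. real (fibre pA (z, w)) * fibre pB (w, y) / fibre p4 w)"
    by (simp add: sum.cartesian_product)
  \<comment> \<open>For a fixed middle vertex the double sum factorises; by \<open>rA\<close> and
    \<open>rB\<close> both factors equal the denominator, so one of them cancels.\<close>
  also have "\<dots> = (\<Sum>w\<in>p4 ` Q. (\<Sum>z\<in>?W. real (fibre pA (z, w))) * (\<Sum>y\<in>?W. real (fibre pB (w, y))) / fibre p4 w)"
    by (simp add: sum_product sum_divide_distrib)
  also have "\<dots> = (\<Sum>w\<in>p4 ` Q. real (fibre p4 w))"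
    by (rule sum.cong) (simp_all only: rA rB of_nat_sum[symmetric] times_divide_eq_right[symmetric], simp)
  also have "\<dots> = T"
    using sum_card_fibres[OF finite_Q, of "p4 ` Q" p4 "\<lambda>_. True"] finite_Q
    by (simp add: fibre_def flip: of_nat_sum)
  finally have tot: "sum ?f ?P = T" .
  show ?le unfolding eq tot[symmetric]
    by (rule sum_mono2[OF fin sub]) (use nn in blast)
  assume T: "sum F2 Q = T" and zw: "(z, w) \<in> pA ` Q" and wy: "(w, y) \<in> pB ` Q"
  show "(w, z, y) \<in> p234 ` Q"
  proof (rule ccontr)
    assume "(w, z, y) \<notin> p234 ` Q"
    moreover have "(w, z, y) \<in> ?P" using zw wy unfolding pA_def pB_def by blast
    ultimately have "(w, z, y) \<in> ?P - p234 ` Q" by blast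
    \<comment> \<open>With equality, the triples outside the image have weight 0, whereas here the
      counts of both edges and of the middle vertex are positive.\<close>
    moreover have "sum ?f (?P - p234 ` Q) = 0"
      using T tot unfolding eq by (simp only: sum_diff[OF fin sub])
    ultimately have "?f (w, z, y) = 0"
      using sum_nonneg_eq_0_iff[of "?P - p234 ` Q" ?f] fin nn by blast
    moreover have "fibre pA (z, w) > 0" "fibre pB (w, y) > 0"
      using zw wy fibre_pos by (metis imageE)+
    moreover have "fibre p4 w > 0"
      using zw fibre_pos[of _ p4] unfolding pA_def by blast
    ultimately show False by simp
  qed
qed

text \<open>By \<open>sum_fibres\<close> the sum is \<open>T\<close> times the fraction of
  \<open>E\<close> that the projection reaches.\<close>

lemma sum_inverse_fibre:
  fixes E :: "'c set"
  assumes "finite E" "\<pi> ` Q \<subseteq> E"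
  shows "(\<Sum>q\<in>Q. T / card E / fibre \<pi> (\<pi> q)) \<le> T" (is ?le)
    and "(\<Sum>q\<in>Q. T / card E / fibre \<pi> (\<pi> q)) = T \<Longrightarrow> Q \<noteq> {} \<Longrightarrow> \<pi> ` Q = E"
proof -
  have eq: "(\<Sum>q\<in>Q. T / card E / fibre \<pi> (\<pi> q)) = T / card E * card (\<pi> ` Q)"
    unfolding fibre_def using sum_fibres[OF finite_Q, of "\<lambda>_. T / card E" \<pi>] by simp
  have le: "card (\<pi> ` Q) \<le> card E" using assms by (rule card_mono)
  then have "T * card (\<pi> ` Q) \<le> T * card E" by (simp add: mult_left_mono)
  then show ?le unfolding eq by (simp add: divide_simps)
  assume "(\<Sum>q\<in>Q. T / card E / fibre \<pi> (\<pi> q)) = T" "Q \<noteq> {}"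
  moreover from \<open>Q \<noteq> {}\<close> have "T > 0" using T_pos by blast
  ultimately have "real (card (\<pi> ` Q)) = card E" unfolding eq by (cases "card E = 0") (simp_all add: field_simps)
  then have "card (\<pi> ` Q) = card E" by simp
  then show "\<pi> ` Q = E" using assms by (simp add: card_subset_eq)
qed

lemma F_pos:
  assumes "q \<in> Q"
  shows "F1 q > 0" "F2 q > 0" "F3 q > 0" "F4 q > 0"
proof -
  have "T > 0" using assms by (rule T_pos)
  moreover have "nA > 0" "nB > 0"
    using nA_pos nB_pos assms by blast+
  moreover have "card (replacements q) > 0"
    using fibre_p234 fibre_pos assms by metis
  ultimately show "F1 q > 0" "F2 q > 0" "F3 q > 0" "F4 q > 0"
    unfolding F1_def F2_def F3_def F4_def using fibre_pos[OF assms, of p1] fibre_pos[OF assms, of pA]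
      fibre_pos[OF assms, of pB] fibre_pos[OF assms, of p4] fibre_pos[OF assms, of p234] by simp_all
qed

text \<open>In the product of the factors t, r and g cancel, and d(x1) / d(x4) remains besides the
  constant. Since \<open>\<sigma>C\<close> permutes \<open>Q\<close> and takes x4 to the first
  place, the logarithms of d cancel in the sum.\<close>

lemma sum_ln_F:
  "(\<Sum>q\<in>Q. ln (F1 q)) + (\<Sum>q\<in>Q. ln (F2 q)) + (\<Sum>q\<in>Q. ln (F3 q)) + (\<Sum>q\<in>Q. ln (F4 q))
     = T * ln (4 * T / (nA * nB))"
proof -
  let ?l = "\<lambda>q. ln (real (fibre p1 (p1 q)))"
  have "ln (F1 q) + ln (F2 q) + ln (F3 q) + ln (F4 q) = ln (4 * T / (nA * nB)) + ?l q - ?l (\<sigma>C q)"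
    if "q \<in> Q" for q
  proof -
    have "T > 0" using that by (rule T_pos)
    moreover have "nA > 0" "nB > 0"
      using nA_pos nB_pos that by blast+
    moreover have "p1 (\<sigma>C q) = p4 q" by (rule p1_\<sigma>C)
    ultimately show ?thesis
      using fibre_pos[OF that, of p1] fibre_pos[OF that, of pA] fibre_pos[OF that, of pB]
        fibre_pos[OF that, of p4] fibre_pos[OF that, of p234]
      unfolding F1_def F2_def F3_def F4_def fibre_p234[OF that, symmetric] fibre_p4
      by (simp add: ln_mult ln_div fibre_p4[symmetric])
  qed
  then have "(\<Sum>q\<in>Q. ln (F1 q) + ln (F2 q) + ln (F3 q) + ln (F4 q))
      = T * ln (4 * T / (nA * nB)) + sum ?l Q - (\<Sum>q\<in>Q. ?l (\<sigma>C q))"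
    by (simp add: sum.distrib sum_subtractf)
  then show ?thesis
    using sum.reindex_bij_betw[OF bij_\<sigma>(3), of ?l] by (simp add: sum.distrib)
qed

lemma sum_F3: "sum F3 Q \<le> T" and sum_F4: "sum F4 Q \<le> T"
  unfolding F3_def F4_def
  using sum_inverse_fibre(1)[OF finite_A pA_Q] sum_inverse_fibre(1)[OF finite_B pB_Q] by simp_all

theorem card_Q_le: "4 * T \<le> nA * nB"
proof (cases "Q = {}")
  case False
  then obtain q where q: "q \<in> Q" by blast
  have T: "T > 0" using q by (rule T_pos)
  have n: "nA > 0" "nB > 0"
    using nA_pos nB_pos q by blast+
  \<comment> \<open>This is the total of the four sums of logarithms, each nonpositive because the
    factor has mean at most 1.\<close>
  have "T * ln (4 * T / (nA * nB)) \<le> 0"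
    unfolding sum_ln_F[symmetric]
    using sum_ln_nonpos(1)[OF finite_Q F_pos(1) sum_F1] sum_ln_nonpos(1)[OF finite_Q F_pos(2) sum_F2]
      sum_ln_nonpos(1)[OF finite_Q F_pos(3) sum_F3] sum_ln_nonpos(1)[OF finite_Q F_pos(4) sum_F4]
    by linarith
  then have "ln (4 * T / (nA * nB)) \<le> 0" using T by (simp add: mult_le_0_iff)
  then show ?thesis using T n by (simp add: divide_simps)
qed (simp del: Collect_empty_eq)

section \<open>The case of equality\<close>

context
  assumes extremal: "4 * T = nA * nB" and nonempty: "Q \<noteq> {}"
begin

text \<open>Four nonpositive sums of logarithms add up to 0, so each is 0 and the equality case of
  \<open>sum_ln_nonpos\<close> applies.\<close>

lemma F_eq_1: assumes "q \<in> Q" shows "F1 q = 1" "F2 q = 1" "F3 q = 1" "F4 q = 1"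
proof -
  have z: "T * ln (4 * T / (nA * nB)) = 0"
    using extremal by auto
  note le = sum_ln_nonpos(1)[OF finite_Q F_pos(1) sum_F1] sum_ln_nonpos(1)[OF finite_Q F_pos(2) sum_F2]
      sum_ln_nonpos(1)[OF finite_Q F_pos(3) sum_F3] sum_ln_nonpos(1)[OF finite_Q F_pos(4) sum_F4]
  have "(\<Sum>q\<in>Q. ln (F1 q)) = 0" "(\<Sum>q\<in>Q. ln (F2 q)) = 0" "(\<Sum>q\<in>Q. ln (F3 q)) = 0"
    "(\<Sum>q\<in>Q. ln (F4 q)) = 0"
    using z le unfolding sum_ln_F[symmetric] by linarith+
  then show "F1 q = 1" "F2 q = 1" "F3 q = 1" "F4 q = 1"
    using assms sum_ln_nonpos(2)[OF finite_Q F_pos(1) sum_F1] sum_ln_nonpos(2)[OF finite_Q F_pos(2) sum_F2]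
      sum_ln_nonpos(2)[OF finite_Q F_pos(3) sum_F3] sum_ln_nonpos(2)[OF finite_Q F_pos(4) sum_F4]
    by blast+
qed

text \<open>Equality for \<open>F3\<close>: every edge of the first colour occurs, in both
  orientations, as the edge 34 of a copy.\<close>

lemma pA_image: "pA ` Q = {(x, y). A x y}"
proof (rule sum_inverse_fibre(2)[OF finite_A pA_Q _ nonempty])
  have "sum F3 Q = T" using F_eq_1(3) by simp
  then show "(\<Sum>q\<in>Q. T / nA / fibre pA (pA q)) = T" by (simp only: F3_def[abs_def])
qed

lemma pB_image: "pB ` Q = {(x, y). B x y}"
proof (rule sum_inverse_fibre(2)[OF finite_B pB_Q _ nonempty])
  have "sum F4 Q = T" using F_eq_1(4) by simp
  then show "(\<Sum>q\<in>Q. T / nB / fibre pB (pB q)) = T" by (simp only: F4_def[abs_def])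
qed

text \<open>Both edges of the path lie in copies, so equality for \<open>F2\<close> puts the whole
  path into one copy, whose edge 23 closes the triangle.\<close>

lemma third_color:
  assumes "A x y" "B y z"
  shows "C x z"
proof -
  have "sum F2 Q = T" using F_eq_1(2) by simp
  moreover have "(x, y) \<in> pA ` Q" "(y, z) \<in> pB ` Q"
    using assms unfolding pA_image pB_image by simp_all
  ultimately have "(y, x, z) \<in> p234 ` Q" by (rule sum_F2_eq)
  then obtain q where "K4 q" "p2 q = z" "p3 q = x" unfolding p234_def by blast
  then have "C z x" by (cases q) (simp add: tuple_defs)
  then show ?thesis by (rule C_sym)
qed

text \<open>Equality for \<open>F1\<close> makes the replacements of a single copy exhaust all
  vertices that lie in copies.\<close>

lemma covered:
  assumes "K4 q" "A x y"
  shows "x \<in> all_replacements q"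
proof -
  have "all_replacements q = p1 ` Q"
  proof (rule sum_F1_eq)
    show "sum F1 Q = T" using F_eq_1(1) by simp
  qed (use assms(1) in simp)
  \<comment> \<open>The reversed edge has \<open>x\<close> at label 4; \<open>\<sigma>C\<close> then
    moves it to label 1.\<close>
  moreover have "(y, x) \<in> pA ` Q" using A_sym[OF assms(2)] unfolding pA_image by simp
  then obtain q' where "q' \<in> Q" "p1 (\<sigma>C q') = x" unfolding p1_\<sigma>C pA_def by blast
  ultimately show ?thesis using \<sigma>_in_Q(3) by blast
qed

text \<open>\<open>F1 = 1\<close> is used at \<open>\<sigma>C q\<close>, whose first vertex is x4.
  This gives 4 t d(x4) = T with t belonging to \<open>\<sigma>C q\<close>; the other three factors
  at \<open>q\<close> give the same equation with t belonging to \<open>q\<close>.\<close>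

lemma card_replacements:
  assumes "K4 q"
  shows "card (replacements q) = card (replacements (\<sigma>C q))"
proof -
  have q: "q \<in> Q" "\<sigma>C q \<in> Q" using assms \<sigma>_in_Q(3)[of q] by simp_all
  note c = p1_\<sigma>C
  have n: "nA > 0" "nB > 0"
    using nA_pos nB_pos q by blast+
  let ?d1 = "real (fibre p1 (p1 q))" and ?d4 = "real (fibre p1 (p4 q))"
  let ?t = "real (card (replacements q))" and ?a = "real (fibre pA (pA q))" and ?b = "real (fibre pB (pB q))"
  have pos: "?d4 > 0" "?t > 0" "?a > 0" "?b > 0"
    using fibre_pos[OF q(1), of pA] fibre_pos[OF q(1), of pB] fibre_pos[OF q(1), of p4] fibre_pos[OF q(1), of p234]
    unfolding fibre_p4 fibre_p234[OF q(1)] by auto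
  have "real (card (replacements (\<sigma>C q))) * (4 * ?d4) = T"
    using F_eq_1(1)[OF q(2)] T_pos[OF q(1)] by (simp add: F1_def c)
  moreover have "?t * ?d4 = ?a * ?b"
    using F_eq_1(2)[OF q(1)] pos by (simp add: F2_def fibre_p4 fibre_p234[OF q(1)] field_simps)
  moreover have "nA * ?a = T" "nB * ?b = T"
    using F_eq_1(3,4)[OF q(1)] pos n by (auto simp: F3_def F4_def field_simps)
  \<comment> \<open>Combined with the extremal identity, this determines the product r g as a
    quarter of \<open>T\<close>.\<close>
  then have "(nA * nB) * (?a * ?b) = T * T"
    by (metis mult.assoc mult.left_commute)
  then have "4 * (?a * ?b) = T" using T_pos[OF q(1)] unfolding extremal[symmetric] by simp
  ultimately have "real (card (replacements (\<sigma>C q))) * (4 * ?d4) = ?t * (4 * ?d4)" by simp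
  then show ?thesis using pos by simp
qed

end

end

section \<open>Coloured graphs and the counting of their copies\<close>

definition has_color :: "'a colored_graph \<Rightarrow> color \<Rightarrow> 'a \<Rightarrow> 'a \<Rightarrow> bool" where
  "has_color \<Gamma> k x y \<longleftrightarrow> {x, y} \<in> color_class \<Gamma> k"

lemma has_color_sym: "has_color \<Gamma> k x y \<Longrightarrow> has_color \<Gamma> k y x"
  by (simp add: has_color_def insert_commute)

lemma has_color_unique: "has_color \<Gamma> k x y \<Longrightarrow> has_color \<Gamma> l x y \<Longrightarrow> k = l"
  by (simp add: has_color_def color_class_def)

lemma has_color_neq: "finite_simple_graph \<Gamma> \<Longrightarrow> has_color \<Gamma> k x y \<Longrightarrow> x \<noteq> y"
  by (auto simp: has_color_def color_class_def finite_simple_graph_def)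

lemma has_color_verts: "finite_simple_graph \<Gamma> \<Longrightarrow> has_color \<Gamma> k x y \<Longrightarrow> x \<in> verts \<Gamma>"
  by (auto simp: has_color_def color_class_def finite_simple_graph_def)

lemma edges_has_color: "{x, y} \<in> edges \<Gamma> \<longleftrightarrow> (\<exists>k. has_color \<Gamma> k x y)"
  by (simp add: has_color_def color_class_def)

lemma color_cases:
  fixes a b c k :: color
  assumes "a \<noteq> b" "a \<noteq> c" "b \<noteq> c"
  obtains "k = a" | "k = b" | "k = c"
  using assms by (cases k; cases a; cases b; cases c) auto

lemma finite_color_class: "finite_simple_graph \<Gamma> \<Longrightarrow> finite (color_class \<Gamma> k)"
  by (rule finite_subset[of _ "Pow (verts \<Gamma>)"])
    (auto simp: finite_simple_graph_def color_class_def)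

lemma edge_colors_has_color:
  assumes \<Gamma>: "finite_simple_graph \<Gamma>" and "a \<noteq> b" "a \<noteq> c" "b \<noteq> c"
  shows "edge_colors (has_color \<Gamma> a) (has_color \<Gamma> b) (has_color \<Gamma> c)"
proof
  have "{(x, y). has_color \<Gamma> k x y} \<subseteq> verts \<Gamma> \<times> verts \<Gamma>" for k
    using has_color_verts[OF \<Gamma>] has_color_sym by fastforce
  moreover have "finite (verts \<Gamma> \<times> verts \<Gamma>)"
    using \<Gamma> by (simp add: finite_simple_graph_def)
  ultimately show "finite {(x, y). has_color \<Gamma> a x y}" "finite {(x, y). has_color \<Gamma> b x y}"
    by (rule finite_subset)+
qed (use assms(2-4) in \<open>auto dest: has_color_sym has_color_unique\<close>)

lemma card_ordered_pairs:
  assumes "finite F" "\<And>e. e \<in> F \<Longrightarrow> card e = 2"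
  shows "card {(x, y). {x, y} \<in> F} = 2 * card F"
proof -
  have two: "finite {(x, y). {x, y} = e} \<and> card {(x, y). {x, y} = e} = 2" if e: "e \<in> F" for e
  proof -
    obtain u v where uv: "e = {u, v}" "u \<noteq> v" using assms(2)[OF e] by (auto simp: card_2_iff)
    then have "{(x, y). {x, y} = e} = {(u, v), (v, u)}" by (auto simp: doubleton_eq_iff)
    then show ?thesis using uv by simp
  qed
  have "{(x, y). {x, y} \<in> F} = (\<Union>e\<in>F. {(x, y). {x, y} = e})" by auto
  also have "card \<dots> = (\<Sum>e\<in>F. card {(x, y). {x, y} = e})"
    by (rule card_UN_disjoint) (use assms(1) two in auto)
  finally show ?thesis using two by simp
qed

lemma card_has_color:
  assumes "finite_simple_graph \<Gamma>"
  shows "card {(x, y). has_color \<Gamma> k x y} = 2 * card (color_class \<Gamma> k)"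
  unfolding has_color_def
  by (rule card_ordered_pairs[OF finite_color_class[OF assms]])
     (use assms in \<open>auto simp: color_class_def finite_simple_graph_def\<close>)

text \<open>The pattern of \<open>K4\<close> with the colours as arguments, so that colours and
  vertices can be permuted together.\<close>

definition colored_K4 :: "'a colored_graph \<Rightarrow> color \<Rightarrow> color \<Rightarrow> color \<Rightarrow> 'a \<Rightarrow> 'a \<Rightarrow> 'a \<Rightarrow> 'a \<Rightarrow> bool" where
  "colored_K4 \<Gamma> a b c x y z w \<longleftrightarrow> has_color \<Gamma> a x y \<and> has_color \<Gamma> a z w \<and>
     has_color \<Gamma> b x z \<and> has_color \<Gamma> b y w \<and> has_color \<Gamma> c x w \<and> has_color \<Gamma> c y z"

text \<open>Fixing \<open>x\<close> and permuting \<open>y\<close>, \<open>z\<close>,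
  \<open>w\<close> cyclically rotates the three colours; facts about the first colour thus carry
  over to all.\<close>

lemma colored_K4_rotate: "colored_K4 \<Gamma> a b c x y z w \<Longrightarrow> colored_K4 \<Gamma> b c a x z w y"
  unfolding colored_K4_def by (auto intro: has_color_sym)

lemma colored_K4_distinct:
  assumes "finite_simple_graph \<Gamma>" "colored_K4 \<Gamma> a b c x y z w"
  shows "distinct [x, y, z, w]"
  using assms(2) unfolding colored_K4_def by (auto dest: has_color_neq[OF assms(1)])

lemma colored_K4_matching:
  assumes \<Gamma>: "finite_simple_graph \<Gamma>" and K: "colored_K4 \<Gamma> a b c x y z w"
    and abc: "a \<noteq> b" "a \<noteq> c" "b \<noteq> c"
  shows "perfect_matching_on {x, y, z, w} {e \<in> color_class \<Gamma> a. e \<subseteq> {x, y, z, w}}"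
proof -
  note d = colored_K4_distinct[OF \<Gamma> K]
  \<comment> \<open>The four remaining pairs have one of the other two colours, so these two
    disjoint edges are the whole class.\<close>
  have "{e \<in> color_class \<Gamma> a. e \<subseteq> {x, y, z, w}} = {{x, y}, {z, w}}"
  proof (intro equalityI subsetI)
    fix e assume e: "e \<in> {e \<in> color_class \<Gamma> a. e \<subseteq> {x, y, z, w}}"
    then have "card e = 2" using \<Gamma> by (auto simp: color_class_def finite_simple_graph_def)
    then obtain u v where uv: "e = {u, v}" "u \<noteq> v" by (auto simp: card_2_iff)
    then have "u \<in> {x, y, z, w}" "v \<in> {x, y, z, w}" "has_color \<Gamma> a u v"
      using e by (auto simp: has_color_def)
    then show "e \<in> {{x, y}, {z, w}}"
      using uv K abc has_color_unique[of \<Gamma> a u v] has_color_sym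
      unfolding colored_K4_def by (smt (verit) insert_iff empty_iff insert_commute)
  next
    fix e assume "e \<in> {{x, y}, {z, w}}"
    then show "e \<in> {e \<in> color_class \<Gamma> a. e \<subseteq> {x, y, z, w}}"
      using K by (auto simp: colored_K4_def has_color_def)
  qed
  then show ?thesis using d unfolding perfect_matching_on_def by (auto simp: card_insert_if)
qed

lemma colored_K4_proper:
  assumes \<Gamma>: "finite_simple_graph \<Gamma>" and K: "colored_K4 \<Gamma> a b c x y z w"
    and abc: "a \<noteq> b" "a \<noteq> c" "b \<noteq> c"
  shows "proper_K4_in \<Gamma> {x, y, z, w}"
  unfolding proper_K4_in_def
proof (intro conjI allI ballI impI)
  show "{x, y, z, w} \<subseteq> verts \<Gamma>"
    using K \<Gamma> by (auto simp: colored_K4_def has_color_def color_class_def finite_simple_graph_def)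
  show "card {x, y, z, w} = 4" using colored_K4_distinct[OF \<Gamma> K] by simp
  have "{x, y} \<in> edges \<Gamma>" "{z, w} \<in> edges \<Gamma>" "{x, z} \<in> edges \<Gamma>" "{y, w} \<in> edges \<Gamma>"
    "{x, w} \<in> edges \<Gamma>" "{y, z} \<in> edges \<Gamma>"
    using K by (simp_all add: colored_K4_def has_color_def color_class_def)
  moreover fix u v assume "u \<in> {x, y, z, w}" "v \<in> {x, y, z, w}" "u \<noteq> v"
  ultimately show "{u, v} \<in> edges \<Gamma>"
    by (auto simp: insert_commute)
next
  fix k
  note K' = colored_K4_rotate[OF K] and K'' = colored_K4_rotate[OF colored_K4_rotate[OF K]]
  have S: "{x, z, w, y} = {x, y, z, w}" "{x, w, y, z} = {x, y, z, w}" by auto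
  show "perfect_matching_on {x, y, z, w} {e \<in> color_class \<Gamma> k. e \<subseteq> {x, y, z, w}}"
    using colored_K4_matching[OF \<Gamma> K] colored_K4_matching[OF \<Gamma> K'] colored_K4_matching[OF \<Gamma> K''] abc
    by (cases rule: color_cases[OF abc, of k]) (simp_all add: S)
qed

text \<open>Given \<open>x\<close>, the labels \<open>y\<close>, \<open>z\<close>, \<open>w\<close>
  must be its partners in the three perfect matchings.\<close>

lemma proper_K4_in_labelling:
  assumes \<Gamma>: "finite_simple_graph \<Gamma>" and S: "proper_K4_in \<Gamma> S" and x: "x \<in> S"
    and abc: "a \<noteq> b" "a \<noteq> c" "b \<noteq> c"
  obtains y z w where "colored_K4 \<Gamma> a b c x y z w" "S = {x, y, z, w}"
proof -
  have pm: "\<exists>!e. e \<in> {e \<in> color_class \<Gamma> k. e \<subseteq> S} \<and> v \<in> e" if "v \<in> S" for k v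
    using S that by (auto simp: proper_K4_in_def perfect_matching_on_def)
  have uniq: "u = u'" if "v \<in> S" "u \<in> S" "u' \<in> S" "has_color \<Gamma> k v u" "has_color \<Gamma> k v u'" for k u u' v
  proof -
    have "{v, u} = {v, u'}" using pm[OF that(1), of k] that by (auto simp: has_color_def)
    then show ?thesis by (auto simp: doubleton_eq_iff)
  qed
  have mate: "\<exists>u\<in>S. has_color \<Gamma> k x u" for k
  proof -
    obtain e where e: "e \<in> color_class \<Gamma> k" "e \<subseteq> S" "x \<in> e" using pm[OF x, of k] by blast
    then have "card e = 2" using \<Gamma> by (auto simp: color_class_def finite_simple_graph_def)
    then obtain u where "e = {x, u}" using e(3) by (auto simp: card_2_iff)
    then show ?thesis using e by (auto simp: has_color_def)
  qed
  obtain y z w where yzw: "y \<in> S" "z \<in> S" "w \<in> S" "has_color \<Gamma> a x y" "has_color \<Gamma> b x z" "has_color \<Gamma> c x w"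
    using mate by meson
  have ne: "x \<noteq> y" "x \<noteq> z" "x \<noteq> w" "y \<noteq> z" "y \<noteq> w" "z \<noteq> w"
    using yzw has_color_neq[OF \<Gamma>] has_color_unique abc by metis+
  have "card S = 4" using S by (simp add: proper_K4_in_def)
  moreover have "finite S" using calculation by (simp add: card_ge_0_finite)
  ultimately have S': "S = {x, y, z, w}"
    using ne x yzw by (intro card_subset_eq[symmetric]) auto
  \<comment> \<open>An edge between partners of \<open>x\<close> cannot repeat the colour in which
    either is joined to \<open>x\<close>, since that vertex would then have two partners in one
    matching.\<close>
  have third: "has_color \<Gamma> m u v"
    if uv: "u \<in> S" "v \<in> S" "u \<noteq> v" "has_color \<Gamma> k x u" "has_color \<Gamma> l x v"
      and klm: "k \<noteq> l" "k \<noteq> m" "l \<noteq> m" for k l m u v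
  proof -
    obtain n where n: "has_color \<Gamma> n u v"
      using S uv unfolding proper_K4_in_def edges_has_color by blast
    have "n \<noteq> k" "n \<noteq> l"
      using uniq[of u x v k] uniq[of v x u l] uv x n has_color_sym has_color_neq[OF \<Gamma>] by metis+
    then have "n = m" using color_cases[OF klm, of n] by blast
    then show ?thesis using n by simp
  qed
  have "colored_K4 \<Gamma> a b c x y z w"
    unfolding colored_K4_def using yzw third[of y z a b c] third[of z w b c a] third[of y w a c b] ne abc
    by blast
  then show thesis using S' that by blast
qed

text \<open>A labelling is the choice of a copy and of its first vertex; the colours of the edges at
  that vertex then fix the other labels.\<close>

lemma card_colored_K4:
  assumes \<Gamma>: "finite_simple_graph \<Gamma>" and abc: "a \<noteq> b" "a \<noteq> c" "b \<noteq> c"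
  shows "card {(x, y, z, w). colored_K4 \<Gamma> a b c x y z w} = 4 * num_proper_K4 \<Gamma>"
proof -
  let ?Q = "{(x, y, z, w). colored_K4 \<Gamma> a b c x y z w}"
  let ?S = "SIGMA S:{S. proper_K4_in \<Gamma> S}. S"
  let ?f = "\<lambda>(x, y, z, w). ({x, y, z, w}, x)"
  have "bij_betw ?f ?Q ?S"
    unfolding bij_betw_def
  proof
    show "inj_on ?f ?Q"
    proof (rule inj_onI, clarsimp)
      fix x y z w y' z' w'
      assume K: "colored_K4 \<Gamma> a b c x y z w" "colored_K4 \<Gamma> a b c x y' z' w'"
        and eq: "{x, y, z, w} = {x, y', z', w'}"
      have "y' \<in> {y, z, w}" "z' \<in> {y, z, w}" "w' \<in> {y, z, w}"
        using colored_K4_distinct[OF \<Gamma> K(1)] colored_K4_distinct[OF \<Gamma> K(2)] eq by auto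
      then show "y = y' \<and> z = z' \<and> w = w'"
        using K abc has_color_unique unfolding colored_K4_def by (metis insert_iff empty_iff)
    qed
    show "?f ` ?Q = ?S"
    proof (intro equalityI subsetI)
      fix p assume "p \<in> ?f ` ?Q"
      then show "p \<in> ?S" using colored_K4_proper[OF \<Gamma> _ abc] by auto
    next
      fix p assume "p \<in> ?S"
      then obtain S x where p: "p = (S, x)" "proper_K4_in \<Gamma> S" "x \<in> S" by auto
      obtain y z w where "colored_K4 \<Gamma> a b c x y z w" "S = {x, y, z, w}"
        by (rule proper_K4_in_labelling[OF \<Gamma> p(2,3) abc])
      then show "p \<in> ?f ` ?Q" unfolding p(1) by (intro image_eqI[of _ _ "(x, y, z, w)"]) auto
    qed
  qed
  then have "card ?Q = card ?S" by (rule bij_betw_same_card)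
  also have "\<dots> = (\<Sum>S\<in>{S. proper_K4_in \<Gamma> S}. card S)"
  proof (rule card_SigmaI)
    show "finite {S. proper_K4_in \<Gamma> S}"
      by (rule finite_subset[of _ "Pow (verts \<Gamma>)"])
        (use \<Gamma> in \<open>auto simp: proper_K4_in_def finite_simple_graph_def\<close>)
    show "\<forall>S\<in>{S. proper_K4_in \<Gamma> S}. finite S"
      by (auto simp: proper_K4_in_def intro: card_ge_0_finite)
  qed
  also have "\<dots> = (\<Sum>S\<in>{S. proper_K4_in \<Gamma> S}. 4)"
    by (rule sum.cong) (auto simp: proper_K4_in_def)
  finally show ?thesis by (simp add: num_proper_K4_def)
qed

section \<open>Two colours of a graph: bound and equality\<close>

context
  fixes \<Gamma> :: "'a colored_graph" and a b c :: color
  assumes \<Gamma>: "finite_simple_graph \<Gamma>" and abc: "a \<noteq> b" "a \<noteq> c" "b \<noteq> c"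
begin

interpretation edge_colors "has_color \<Gamma> a" "has_color \<Gamma> b" "has_color \<Gamma> c"
  using \<Gamma> abc by (rule edge_colors_has_color)

lemma K4_colored_K4: "K4 (x, y, z, w) = colored_K4 \<Gamma> a b c x y z w"
  by (simp add: K4_def colored_K4_def)

lemma T_num_proper_K4: "card (Collect K4) = 4 * num_proper_K4 \<Gamma>"
proof -
  have "Collect K4 = {(x, y, z, w). colored_K4 \<Gamma> a b c x y z w}"
    by (auto simp: K4_colored_K4)
  then show ?thesis using card_colored_K4[OF \<Gamma> abc] by simp
qed

lemma num_proper_K4_le:
  "4 * num_proper_K4 \<Gamma> \<le> card (color_class \<Gamma> a) * card (color_class \<Gamma> b)"
proof -
  \<comment> \<open>Each copy has four labellings and each edge two orientations.\<close>
  have "4 * (4 * num_proper_K4 \<Gamma>) \<le> (2 * card (color_class \<Gamma> a)) * (2 * card (color_class \<Gamma> b))"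
    using card_Q_le unfolding T_num_proper_K4 card_has_color[OF \<Gamma>]
    by (metis of_nat_mult of_nat_le_iff of_nat_numeral)
  then show ?thesis by simp
qed

context
  assumes extremal: "4 * num_proper_K4 \<Gamma> = card (color_class \<Gamma> a) * card (color_class \<Gamma> b)"
    and nonempty: "num_proper_K4 \<Gamma> > 0"
begin

lemma extremal': "4 * T = nA * nB" and nonempty': "Q \<noteq> {}"
proof -
  have "4 * (4 * num_proper_K4 \<Gamma>) = (2 * card (color_class \<Gamma> a)) * (2 * card (color_class \<Gamma> b))"
    using extremal by simp
  then show "4 * T = nA * nB"
    unfolding T_num_proper_K4 card_has_color[OF \<Gamma>]
    by (metis of_nat_mult of_nat_numeral)
  show "Q \<noteq> {}" using T_num_proper_K4 nonempty by (metis card.empty mult_eq_0_iff not_less_zero zero_neq_numeral neq0_conv)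
qed

lemma extremal_third_color:
  "has_color \<Gamma> a x y \<Longrightarrow> has_color \<Gamma> b y z \<Longrightarrow> has_color \<Gamma> c x z"
  by (rule third_color[OF extremal' nonempty'])

text \<open>The four alternatives say that \<open>u\<close> can replace \<open>x\<close>,
  \<open>y\<close>, \<open>z\<close> or \<open>w\<close>, in this order.\<close>

lemma extremal_covered:
  assumes "colored_K4 \<Gamma> a b c x y z w" "has_color \<Gamma> a u v"
  shows "(has_color \<Gamma> a u y \<and> has_color \<Gamma> b u z \<and> has_color \<Gamma> c u w) \<or>
    (has_color \<Gamma> a u x \<and> has_color \<Gamma> b u w \<and> has_color \<Gamma> c u z) \<or>
    (has_color \<Gamma> a u w \<and> has_color \<Gamma> b u x \<and> has_color \<Gamma> c u y) \<or>
    (has_color \<Gamma> a u z \<and> has_color \<Gamma> b u y \<and> has_color \<Gamma> c u x)"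
  using covered[OF extremal' nonempty', unfolded K4_colored_K4, of "(x, y, z, w)" u v]
    assms K4_colored_K4
  by (simp add: all_replacements_def replacements_def \<sigma>A_def \<sigma>B_def \<sigma>C_def)

text \<open>This compares the parts of \<open>x\<close> and \<open>w\<close> only; rotating the
  colours puts \<open>y\<close> or \<open>z\<close> in the last place.\<close>

lemma extremal_card:
  assumes "colored_K4 \<Gamma> a b c x y z w"
  shows "card {u. has_color \<Gamma> a u y \<and> has_color \<Gamma> b u z \<and> has_color \<Gamma> c u w} =
    card {u. has_color \<Gamma> a u z \<and> has_color \<Gamma> b u y \<and> has_color \<Gamma> c u x}"
  using card_replacements[OF extremal' nonempty', of "(x, y, z, w)"] assms K4_colored_K4
  by (simp add: replacements_def \<sigma>C_def)

end

end

section \<open>The template and the structure of the blowup\<close>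

text \<open>The colour of the edge \<open>{i, j}\<close> of the template on \<open>{0, 1, 2, 3}\<close> is determined by \<open>i + j\<close>.\<close>

definition sum_color :: "nat \<Rightarrow> color" where
  "sum_color s = (if s = 1 \<or> s = 5 then Red else if s = 2 \<or> s = 4 then Green else Blue)"

definition template :: "nat colored_graph" where
  "template = \<lparr>verts = {..<4}, edges = {{i, j} |i j. i < 4 \<and> j < 4 \<and> i \<noteq> j},
     color_of = (\<lambda>e. sum_color (\<Sum> e))\<rparr>"

lemma template_edge: "{i, j} \<in> edges template \<longleftrightarrow> i < 4 \<and> j < 4 \<and> i \<noteq> j"
  by (auto simp: template_def doubleton_eq_iff)

lemma template_color: "i \<noteq> j \<Longrightarrow> color_of template {i, j} = sum_color (i + j)"
  by (simp add: template_def)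

lemma finite_simple_template: "finite_simple_graph template"
  by (auto simp: finite_simple_graph_def template_def)

lemma template_K4: "properly_colored_K4 template"
proof -
  have "colored_K4 template Red Green Blue 0 1 2 3"
    by (simp add: colored_K4_def has_color_def color_class_def template_edge template_color sum_color_def)
  then have "proper_K4_in template {0, 1, 2, 3}"
    by (rule colored_K4_proper[OF finite_simple_template]) simp_all
  moreover have "verts template = {0, 1, 2, 3}" by (auto simp: template_def)
  ultimately show ?thesis by (simp add: properly_colored_K4_def finite_simple_template)
qed

text \<open>Every triangle of the properly coloured template has three different colours; the
  finitely many pairs are checked by evaluation.\<close>

lemma ex_third_vertex:
  assumes "i < 4" "j < 4" "i \<noteq> j"
  obtains l where "l < (4::nat)" "l \<noteq> i" "l \<noteq> j" "sum_color (i + l) \<noteq> sum_color (j + l)"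
    "sum_color (i + l) \<noteq> sum_color (i + j)" "sum_color (j + l) \<noteq> sum_color (i + j)"
proof -
  have "\<forall>i\<in>{0, 1, 2, 3}. \<forall>j\<in>{0, 1, 2, 3}. i \<noteq> j \<longrightarrow> (\<exists>l\<in>{0, 1, 2, 3}. l \<noteq> i \<and> l \<noteq> j \<and>
    sum_color (i + l) \<noteq> sum_color (j + l) \<and> sum_color (i + l) \<noteq> sum_color (i + j) \<and>
    sum_color (j + l) \<noteq> sum_color (i + j))"
    by (simp add: sum_color_def)
  moreover have "i \<in> {0, 1, 2, 3}" "j \<in> {0, 1, 2, 3}" using assms by auto
  ultimately obtain l where "l \<in> {0, 1, 2, 3}" "l \<noteq> i" "l \<noteq> j" "sum_color (i + l) \<noteq> sum_color (j + l)"
    "sum_color (i + l) \<noteq> sum_color (i + j)" "sum_color (j + l) \<noteq> sum_color (i + j)"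
    using assms(3) by meson
  then show thesis by (intro that[of l]) auto
qed

lemma ex_other_color:
  assumes "i < 4"
  obtains j where "j < (4::nat)" "j \<noteq> i" "sum_color (i + j) \<noteq> k"
proof -
  have "i \<in> {0, 1, 2, 3}" using assms by auto
  then have "\<exists>j\<in>{0, 1, 2, 3}. j \<noteq> i \<and> sum_color (i + j) \<noteq> k"
    by (cases k) (auto simp: sum_color_def)
  then obtain j where "j \<in> {0, 1, 2, 3}" "j \<noteq> i" "sum_color (i + j) \<noteq> k" by blast
  then show thesis by (intro that[of j]) auto
qed

lemma ex_third_color:
  fixes k l :: color
  obtains m where "k \<noteq> m" "l \<noteq> m"
  using that[of Red] that[of Green] that[of Blue] by (cases k; cases l) simp_all

text \<open>\<open>P i\<close> collects the vertices joined to the \<open>X j\<close> as the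
  template prescribes for \<open>i\<close>. The third-colour rule transfers these colours from the
  vertices \<open>X j\<close> to the whole parts.\<close>

lemma blowup_structure:
  fixes \<Gamma> :: "'a colored_graph" and X :: "nat \<Rightarrow> 'a"
  defines "P \<equiv> \<lambda>i. {u. \<forall>j<4. j \<noteq> i \<longrightarrow> has_color \<Gamma> (sum_color (i + j)) u (X j)}"
  assumes \<Gamma>: "finite_simple_graph \<Gamma>"
    and third: "\<And>k l m u v w. k \<noteq> l \<Longrightarrow> k \<noteq> m \<Longrightarrow> l \<noteq> m \<Longrightarrow>
      has_color \<Gamma> k u v \<Longrightarrow> has_color \<Gamma> l v w \<Longrightarrow> has_color \<Gamma> m u w"
    and cover: "\<And>k u v. has_color \<Gamma> k u v \<Longrightarrow> \<exists>i<4. u \<in> P i"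
    and card_P: "\<And>i. i < 4 \<Longrightarrow> card (P i) = n" and "n > 0"
  shows "balanced_blowup template (\<Gamma>\<lparr>verts := \<Union>i<4. P i\<rparr>)"
    and "(\<Union>i<4. P i) \<subseteq> verts \<Gamma>"
proof -
  have P: "has_color \<Gamma> (sum_color (i + j)) u (X j)" if "u \<in> P i" "j < 4" "j \<noteq> i" for i j u
    using that by (simp add: P_def)
  have across: "has_color \<Gamma> (sum_color (i + j)) u v"
    if "i < 4" "j < 4" "i \<noteq> j" "u \<in> P i" "v \<in> P j" for i j u v
  proof -
    \<comment> \<open>Go from \<open>u\<close> to \<open>v\<close> through \<open>X l\<close>: the
      colours on the way are those of two sides of a template triangle, and the rule yields the
      colour of its third side.\<close>
    obtain l where l: "l < 4" "l \<noteq> i" "l \<noteq> j" "sum_color (i + l) \<noteq> sum_color (j + l)"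
      "sum_color (i + l) \<noteq> sum_color (i + j)" "sum_color (j + l) \<noteq> sum_color (i + j)"
      using ex_third_vertex[OF \<open>i < 4\<close> \<open>j < 4\<close> \<open>i \<noteq> j\<close>] .
    show ?thesis
      by (rule third[OF l(4-6) P[OF that(4) l(1,2)] has_color_sym[OF P[OF that(5) l(1,3)]]])
  qed
  have independent: "\<not> has_color \<Gamma> k u v" if "i < 4" "u \<in> P i" "v \<in> P i" for i k u v
  proof
    assume uv: "has_color \<Gamma> k u v"
    \<comment> \<open>The path from \<open>u\<close> via \<open>v\<close> to \<open>X j\<close> has
      two different colours, so the rule forces the third colour on \<open>u\<close> and
      \<open>X j\<close>, against \<open>u \<in> P i\<close>.\<close>
    obtain j where j: "j < 4" "j \<noteq> i" "sum_color (i + j) \<noteq> k" using ex_other_color[OF \<open>i < 4\<close>] .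
    obtain m where m: "k \<noteq> m" "sum_color (i + j) \<noteq> m"
      using ex_third_color .
    have "has_color \<Gamma> m u (X j)"
      by (rule third[OF j(3)[symmetric] m uv P[OF that(3) j(1,2)]])
    from has_color_unique[OF P[OF that(2) j(1,2)] this] m(2) show False by contradiction
  qed
  have disj: "P i \<inter> P j = {}" if ij: "i < 4" "j < 4" "i \<noteq> j" for i j
  proof -
    \<comment> \<open>A common vertex would be joined to \<open>X l\<close> in two different
      colours.\<close>
    obtain l where l: "l < 4" "l \<noteq> i" "l \<noteq> j" "sum_color (i + l) \<noteq> sum_color (j + l)"
      using ex_third_vertex[OF ij] .
    have False if "u \<in> P i" "u \<in> P j" for u
      using has_color_unique[OF P[OF that(1) l(1,2)] P[OF that(2) l(1,3)]] l(4) by contradiction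
    then show ?thesis by blast
  qed
  have edge: "e \<in> edges \<Gamma> \<longleftrightarrow> (\<exists>x y u v. e = {x, y} \<and> {u, v} \<in> edges template \<and> x \<in> P u \<and> y \<in> P v)" for e
  proof
    assume e: "e \<in> edges \<Gamma>"
    then have "card e = 2" using \<Gamma> by (simp add: finite_simple_graph_def)
    then obtain x y where xy: "e = {x, y}" by (auto simp: card_2_iff)
    then obtain k where k: "has_color \<Gamma> k x y" using e edges_has_color[of x y \<Gamma>] by blast
    obtain i where i: "i < 4" "x \<in> P i" using cover[OF k] by blast
    obtain j where j: "j < 4" "y \<in> P j" using cover[OF has_color_sym[OF k]] by blast
    have "i \<noteq> j" using independent[OF i] j(2) k by blast
    then have "{i, j} \<in> edges template" using i j by (simp add: template_edge)
    then show "\<exists>x y u v. e = {x, y} \<and> {u, v} \<in> edges template \<and> x \<in> P u \<and> y \<in> P v"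
      using xy i j by blast
  next
    assume "\<exists>x y u v. e = {x, y} \<and> {u, v} \<in> edges template \<and> x \<in> P u \<and> y \<in> P v"
    then obtain x y u v where e: "e = {x, y}" "{u, v} \<in> edges template" "x \<in> P u" "y \<in> P v"
      by blast
    then have "has_color \<Gamma> (sum_color (u + v)) x y"
      by (intro across) (simp_all add: template_edge)
    then show "e \<in> edges \<Gamma>" using e(1) by (simp add: has_color_def color_class_def)
  qed
  have color: "color_of \<Gamma> {x, y} = color_of template {u, v}"
    if "{u, v} \<in> edges template" "x \<in> P u" "y \<in> P v" for u v x y
  proof -
    have uv: "u < 4" "v < 4" "u \<noteq> v" using that(1) by (simp_all add: template_edge)
    show ?thesis
      using across[OF uv that(2,3)] template_color[OF uv(3)]
      by (simp add: has_color_def color_class_def)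
  qed
  have vt: "verts template = {..<4}" by (simp add: template_def)
  show "balanced_blowup template (\<Gamma>\<lparr>verts := \<Union>i<4. P i\<rparr>)"
    unfolding balanced_blowup_def vt
  proof (intro exI conjI)
    show "n > 0" by fact
    show "\<forall>w\<in>{..<4}. card (P w) = n" using card_P by simp
    show "disjoint_family_on P {..<4}" using disj by (simp add: disjoint_family_on_def)
    show "edges (\<Gamma>\<lparr>verts := \<Union>i<4. P i\<rparr>) =
        {{x, y} |x y u v. {u, v} \<in> edges template \<and> x \<in> P u \<and> y \<in> P v}"
      using edge by (intro set_eqI) simp
    show "\<forall>u v x y. {u, v} \<in> edges template \<longrightarrow> x \<in> P u \<longrightarrow> y \<in> P v \<longrightarrow>
        color_of (\<Gamma>\<lparr>verts := \<Union>i<4. P i\<rparr>) {x, y} = color_of template {u, v}"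
      using color by simp
  qed simp
  show "(\<Union>i<4. P i) \<subseteq> verts \<Gamma>"
  proof clarify
    fix i :: nat and u assume iu: "i < 4" "u \<in> P i"
    obtain j where "j < 4" "j \<noteq> i" using ex_other_color[OF iu(1)] .
    then show "u \<in> verts \<Gamma>" by (rule has_color_verts[OF \<Gamma> P[OF iu(2)]])
  qed
qed

text \<open>The parts are the replacements for the four vertices of one fixed copy. Extremality for
  all pairs of colours gives the third-colour rule in every order and, by rotation, the covering and
  the equal sizes.\<close>

lemma extremal_blowup:
  fixes \<Gamma> :: "'a colored_graph"
  assumes \<Gamma>: "finite_simple_graph \<Gamma>" and pos: "num_proper_K4 \<Gamma> > 0"
    and ext: "\<And>k l. k \<noteq> l \<Longrightarrow>
      4 * num_proper_K4 \<Gamma> = card (color_class \<Gamma> k) * card (color_class \<Gamma> l)"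
  shows "\<exists>(H :: nat colored_graph) \<Delta> I. properly_colored_K4 H \<and> balanced_blowup H \<Delta> \<and>
    I \<inter> verts \<Delta> = {} \<and> \<Gamma> = add_isolated_vertices I \<Delta>"
proof -
  have "{(x, y, z, w). colored_K4 \<Gamma> Red Green Blue x y z w} \<noteq> {}"
    using card_colored_K4[OF \<Gamma>, of Red Green Blue] pos by (metis card.empty color.distinct(1,3,5) mult_eq_0_iff neq0_conv zero_neq_numeral)
  then obtain x y z w where K: "colored_K4 \<Gamma> Red Green Blue x y z w" by auto
  note K' = colored_K4_rotate[OF K] and K'' = colored_K4_rotate[OF colored_K4_rotate[OF K]]
  define X where "X = (\<lambda>i::nat. if i = 0 then x else if i = 1 then y else if i = 2 then z else w)"
  define P where "P = (\<lambda>i. {u. \<forall>j<4. j \<noteq> i \<longrightarrow> has_color \<Gamma> (sum_color (i + j)) u (X j)})"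
  have all4: "(\<forall>j<4. p j) \<longleftrightarrow> p 0 \<and> p 1 \<and> p 2 \<and> p 3" and ex4: "(\<exists>j<4. p j) \<longleftrightarrow> p 0 \<or> p 1 \<or> p 2 \<or> p 3" for p :: "nat \<Rightarrow> bool"
    by (auto simp: numeral_eq_Suc less_Suc_eq)
  have P: "P 0 = {u. has_color \<Gamma> Red u y \<and> has_color \<Gamma> Green u z \<and> has_color \<Gamma> Blue u w}"
    "P 1 = {u. has_color \<Gamma> Red u x \<and> has_color \<Gamma> Green u w \<and> has_color \<Gamma> Blue u z}"
    "P 2 = {u. has_color \<Gamma> Red u w \<and> has_color \<Gamma> Green u x \<and> has_color \<Gamma> Blue u y}"
    "P 3 = {u. has_color \<Gamma> Red u z \<and> has_color \<Gamma> Green u y \<and> has_color \<Gamma> Blue u x}"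
    unfolding P_def all4 by (auto simp: X_def sum_color_def)
  have third: "has_color \<Gamma> m u w"
    if "k \<noteq> l" "k \<noteq> m" "l \<noteq> m" "has_color \<Gamma> k u v" "has_color \<Gamma> l v w" for k l m u v w
    using extremal_third_color[OF \<Gamma> that(1-3) ext pos that(4,5)] that(1) by blast
  have cover: "\<exists>i<4. u \<in> P i" if "has_color \<Gamma> k u v" for k u v
    unfolding ex4
  \<comment> \<open>The copy is rotated so that the colour of the given edge comes first.\<close>
  proof (cases k)
    case Red
    then show "u \<in> P 0 \<or> u \<in> P 1 \<or> u \<in> P 2 \<or> u \<in> P 3"
      using extremal_covered[OF \<Gamma> _ _ _ ext pos K, of u v] that unfolding P by auto
  next
    case Green
    then show "u \<in> P 0 \<or> u \<in> P 1 \<or> u \<in> P 2 \<or> u \<in> P 3"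
      using extremal_covered[OF \<Gamma> _ _ _ ext pos K', of u v] that unfolding P by auto
  next
    case Blue
    then show "u \<in> P 0 \<or> u \<in> P 1 \<or> u \<in> P 2 \<or> u \<in> P 3"
      using extremal_covered[OF \<Gamma> _ _ _ ext pos K'', of u v] that unfolding P by auto
  qed
  \<comment> \<open>One comparison with the part of \<open>x\<close> from each rotation, with
    \<open>w\<close>, \<open>y\<close> and \<open>z\<close> in last place.\<close>
  have "card (P 3) = card (P 0)" "card (P 1) = card (P 0)" "card (P 2) = card (P 0)"
    using extremal_card[OF \<Gamma> _ _ _ ext pos K] extremal_card[OF \<Gamma> _ _ _ ext pos K']
      extremal_card[OF \<Gamma> _ _ _ ext pos K'']
    unfolding P by (simp_all add: conj_ac)
  then have "\<forall>i<4. card (P i) = card (P 0)" unfolding all4 by blast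
  then have card_P: "card (P i) = card (P 0)" if "i < 4" for i using that by blast
  have "x \<in> P 0" using K unfolding P colored_K4_def by simp
  moreover have "finite (P 0)"
    by (rule finite_subset[of _ "verts \<Gamma>"])
      (use \<Gamma> has_color_verts[OF \<Gamma>] in \<open>auto simp: P finite_simple_graph_def\<close>)
  ultimately have pos0: "card (P 0) > 0" using card_gt_0_iff by blast
  note st = blowup_structure[OF \<Gamma> third cover[unfolded P_def] card_P[unfolded P_def] pos0[unfolded P_def],
      folded P_def]
  define \<Delta> where "\<Delta> = \<Gamma>\<lparr>verts := \<Union>i<4. P i\<rparr>"
  \<comment> \<open>By \<open>cover\<close>, an endpoint of an edge lies in some part, so these
    vertices are isolated.\<close>
  define I where "I = verts \<Gamma> - (\<Union>i<4. P i)"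
  have "\<Gamma> = add_isolated_vertices I \<Delta>"
    using st(2) by (simp add: add_isolated_vertices_def \<Delta>_def I_def Un_absorb1)
  moreover have "I \<inter> verts \<Delta> = {}" by (auto simp: I_def \<Delta>_def)
  moreover have "balanced_blowup template \<Delta>" unfolding \<Delta>_def by (rule st(1))
  ultimately show ?thesis using template_K4 by blast
qed

section \<open>Combining the bounds for the three pairs of colours\<close>

text \<open>The product of the three bounds is \<open>k^3 \<le> (r * g * b)^2\<close>, and cube
  roots are taken. With equality, three numbers that are at least \<open>k > 0\<close> have product
  \<open>k^3\<close>, so none can exceed \<open>k\<close>.\<close>

lemma le_powr_two_thirds:
  fixes k r g b :: real
  assumes "k \<ge> 0" "r \<ge> 0" "g \<ge> 0" "b \<ge> 0" "k \<le> r * g" "k \<le> r * b" "k \<le> g * b"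
  shows "k \<le> (r * g * b) powr (2/3)"
    and "k = (r * g * b) powr (2/3) \<Longrightarrow> k > 0 \<Longrightarrow> k = r * g \<and> k = r * b \<and> k = g * b"
proof -
  have prod: "(r * g) * (r * b) * (g * b) = (r * g * b)^2" by (simp add: power2_eq_square)
  have "k * k * k \<le> (r * g) * (r * b) * (g * b)"
    using assms by (intro mult_mono) auto
  then have le: "k^3 \<le> (r * g * b)^2" unfolding prod by (simp add: power3_eq_cube)
  have cube: "((r * g * b) powr (2/3))^3 = (r * g * b)^2" if "r * g * b > 0"
    using that by (simp flip: powr_numeral powr_realpow add: powr_powr)
  show "k \<le> (r * g * b) powr (2/3)"
  proof (cases "r * g * b > 0")
    case True
    then show ?thesis using le cube power_mono_iff[of k "(r * g * b) powr (2/3)" 3] assms(1) by simp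
  next
    case False
    \<comment> \<open>A vanishing factor occurs in one of the pairwise bounds, which forces
      \<open>k\<close> to be 0.\<close>
    then have "r * g * b = 0" using assms by (simp add: order_less_le)
    then have "k \<le> 0" using assms(5-7) by auto
    then show ?thesis using powr_ge_zero by (rule order_trans)
  qed
  assume eq: "k = (r * g * b) powr (2/3)" and "k > 0"
  then have "r * g * b > 0" using assms by (cases "r * g * b = 0") (auto simp: order_less_le)
  then have k3: "k * k * k = (r * g) * (r * b) * (g * b)"
    using cube eq prod by (simp add: power3_eq_cube)
  have "x = k" if "k \<le> x" "k \<le> y" "k \<le> z" "k * k * k = x * y * z" for x y z
  proof (rule ccontr)
    assume "x \<noteq> k"
    moreover have "k * k \<le> y * z" using that \<open>k > 0\<close> by (intro mult_mono) auto
    ultimately have "k * (k * k) < x * (y * z)"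
      using that(1) \<open>k > 0\<close> by (intro mult_less_le_imp_less) auto
    then show False using that(4) by (simp add: mult.assoc)
  qed
  from this[of "r * g" "r * b" "g * b"] this[of "r * b" "r * g" "g * b"] this[of "g * b" "r * b" "r * g"]
  show "k = r * g \<and> k = r * b \<and> k = g * b" using k3 assms by (simp add: ac_simps)
qed

theorem theorem1p3:
  fixes \<Gamma> :: "'a colored_graph" and R G B K :: nat
  assumes "finite_simple_graph \<Gamma>"
    and "R = card (color_class \<Gamma> Red)"
    and "G = card (color_class \<Gamma> Green)"
    and "B = card (color_class \<Gamma> Blue)"
    and "K = num_proper_K4 \<Gamma>"
  shows "real K \<le> 1/4 * (real R * real G * real B) powr (2/3) \<and>
    (real K = 1/4 * (real R * real G * real B) powr (2/3) \<and> K > 0 \<longrightarrow>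
      (\<exists>(H :: nat colored_graph) (\<Delta> :: 'a colored_graph) I.
         properly_colored_K4 H \<and> balanced_blowup H \<Delta> \<and>
         I \<inter> verts \<Delta> = {} \<and> \<Gamma> = add_isolated_vertices I \<Delta>))"
proof (intro conjI impI)
  note le = num_proper_K4_le[OF assms(1), folded assms(5)]
  \<comment> \<open>In each instance the first two colours are counted and the third is the
    remaining one; \<open>4 * K\<close> on the left accounts for the factor 1/4.\<close>
  have "4 * K \<le> R * G" "4 * K \<le> R * B" "4 * K \<le> G * B"
    using le[of Red Green Blue] le[of Red Blue Green] le[of Green Blue Red] assms(2-4) by simp_all
  then have "real (4 * K) \<le> real (R * G)" "real (4 * K) \<le> real (R * B)" "real (4 * K) \<le> real (G * B)"
    by (simp_all only: of_nat_le_iff)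
  then have bounds: "4 * real K \<le> real R * real G" "4 * real K \<le> real R * real B" "4 * real K \<le> real G * real B"
    by simp_all
  show "real K \<le> 1/4 * (real R * real G * real B) powr (2/3)"
    using le_powr_two_thirds(1)[OF _ _ _ _ bounds] by simp
  assume eq: "real K = 1/4 * (real R * real G * real B) powr (2/3) \<and> K > 0"
  then have "4 * real K = real R * real G \<and> 4 * real K = real R * real B \<and> 4 * real K = real G * real B"
    by (intro le_powr_two_thirds(2)[OF _ _ _ _ bounds]) auto
  then have "real (4 * K) = real (R * G)" "real (4 * K) = real (R * B)" "real (4 * K) = real (G * B)"
    unfolding of_nat_mult of_nat_numeral by blast+
  then have nat: "4 * K = R * G" "4 * K = R * B" "4 * K = G * B"
    by (simp_all only: of_nat_eq_iff)
  show "\<exists>(H :: nat colored_graph) (\<Delta> :: 'a colored_graph) I.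
         properly_colored_K4 H \<and> balanced_blowup H \<Delta> \<and>
         I \<inter> verts \<Delta> = {} \<and> \<Gamma> = add_isolated_vertices I \<Delta>"
  proof (rule extremal_blowup[OF assms(1)])
    show "num_proper_K4 \<Gamma> > 0" using eq assms(5) by simp
    show "4 * num_proper_K4 \<Gamma> = card (color_class \<Gamma> k) * card (color_class \<Gamma> l)" if "k \<noteq> l" for k l
      using that nat assms(2-5) by (cases k; cases l) (simp_all add: mult.commute)
  qed
qed

end
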